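(* Let $A$ be a countable structure. Assume that for any pair $f_0,g_0\in\operatorname{Ism}(A)$ there are a finite set $X\subset A$ and $f_1,g_1,h\in\operatorname{Ism}(A)$ such that (1) $f_0\subset f_1$ and $g_0\subset g_1$; (2) $X\subset\operatorname{dom}f_1\cap\operatorname{dom}g_1$; (3) $f_1(X)=X=g_1(X)$; (4) $X\subset\operatorname{dom}h$ and $h(X)\nsubseteq X$. Then the set $$\{(f,g)\in\operatorname{Aut}(A)\times\operatorname{Aut}(A):\langle f,g\rangle\text{ is dense in }\operatorname{Aut}(A)\}$$ is nowhere dense in $\operatorname{Aut}(A)\times\operatorname{Aut}(A)$.
   Context: $A$ is a countable structure whose finitely generated substructures are finite (e.g. a relational structure). $\operatorname{Ism}(A)$ is the set of all partial isomorphisms of $A$, i.e. isomorphisms between two finite substructures of $A$; $\operatorname{dom}f$ is the domain of $f$. Functions are identified with their graphs, so $f_0\subset f_1$ means that $f_1$ extends $f_0$. $\operatorname{Aut}(A)$ is the automorphism group of $A$, with the topology generated by the basic sets $\{\bar f\in\operatorname{Aut}(A): f\subset\bar f\}$, $f\in\operatorname{Ism}(A)$. $\langle f,g\rangle$ is the subgroup generated by $f$ and $g$.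
   Formalization: The formal theorem also assumes that A is ultrahomogeneous (every f in Ism(A) extends to an automorphism of A); without this the claim fails, e.g. for (ℕ,<), which satisfies (1)–(4) but has trivial Aut(A). *)

theory Defs
  imports "HOL-Analysis.Function_Topology" "HOL-Analysis.Product_Topology"
    "HOL-Algebra.Generated_Groups"
begin

text \<open>
  First-order structures over an arbitrary language. The sets of function and relation symbols are
  explicit so that, e.g., relational structures are covered (no function symbols); constants are
  function symbols of arity 0. Interpretations are only meaningful on argument lists over the
  universe whose length is the arity of the symbol.
\<close>

record ('a, 'f, 'r) fo_struct =
  universe :: "'a set"
  funs :: "'f set"
  fun_arity :: "'f \<Rightarrow> nat"
  fun_interp :: "'f \<Rightarrow> 'a list \<Rightarrow> 'a"
  rels :: "'r set"
  rel_arity :: "'r \<Rightarrow> nat"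
  rel_interp :: "'r \<Rightarrow> 'a list \<Rightarrow> bool"

definition closed_under_funs :: "('a, 'f, 'r) fo_struct \<Rightarrow> 'a set \<Rightarrow> bool" where
  "closed_under_funs A B \<longleftrightarrow>
     (\<forall>s\<in>funs A. \<forall>xs\<in>lists B. length xs = fun_arity A s \<longrightarrow> fun_interp A s xs \<in> B)"

definition fo_structure :: "('a, 'f, 'r) fo_struct \<Rightarrow> bool" where
  "fo_structure A \<longleftrightarrow> closed_under_funs A (universe A)"

text \<open>A substructure is identified with its universe.\<close>

definition substructure :: "('a, 'f, 'r) fo_struct \<Rightarrow> 'a set \<Rightarrow> bool" where
  "substructure A B \<longleftrightarrow> B \<subseteq> universe A \<and> closed_under_funs A B"

definition generated_substructure :: "('a, 'f, 'r) fo_struct \<Rightarrow> 'a set \<Rightarrow> 'a set" where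
  "generated_substructure A S = \<Inter>{B. substructure A B \<and> S \<subseteq> B}"

definition finitely_generated_finite :: "('a, 'f, 'r) fo_struct \<Rightarrow> bool" where
  "finitely_generated_finite A \<longleftrightarrow>
     (\<forall>S. finite S \<and> S \<subseteq> universe A \<longrightarrow> finite (generated_substructure A S))"

text \<open>
  Functions identified with their graphs are rendered as partial maps: extension is \<open>\<subseteq>\<^sub>m\<close>, composition is \<open>\<circ>\<^sub>m\<close>,
  and the image of a set \<open>X\<close> contained in \<open>dom f\<close> is \<open>ran (f |` X)\<close>.
\<close>

definition substructure_iso ::
  "('a, 'f, 'r) fo_struct \<Rightarrow> 'a set \<Rightarrow> 'a set \<Rightarrow> ('a \<rightharpoonup> 'a) \<Rightarrow> bool" where
  "substructure_iso A B C f \<longleftrightarrow>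
     substructure A B \<and> substructure A C \<and>
     dom f = B \<and> ran f = C \<and> inj_on f B \<and>
     (\<forall>s\<in>funs A. \<forall>xs\<in>lists B. length xs = fun_arity A s \<longrightarrow>
        f (fun_interp A s xs) = Some (fun_interp A s (map (the \<circ> f) xs))) \<and>
     (\<forall>r\<in>rels A. \<forall>xs\<in>lists B. length xs = rel_arity A r \<longrightarrow>
        rel_interp A r (map (the \<circ> f) xs) = rel_interp A r xs)"

definition Ism :: "('a, 'f, 'r) fo_struct \<Rightarrow> ('a \<rightharpoonup> 'a) set" where
  "Ism A = {f. \<exists>B C. finite B \<and> finite C \<and> substructure_iso A B C f}"

definition Aut :: "('a, 'f, 'r) fo_struct \<Rightarrow> ('a \<rightharpoonup> 'a) set" where
  "Aut A = {f. substructure_iso A (universe A) (universe A) f}"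

text \<open>
  Without ultrahomogeneity the basic sets of the topology below can be empty. The rigid structure
  \<open>(\<nat>, <)\<close> then satisfies all other hypotheses of the theorem (extend two finite
  increasing maps by a fixed point \<open>n\<close> beyond both, and take \<open>X = {n}\<close>,
  \<open>h = [n \<mapsto> n + 1]\<close>), but every pair of automorphisms of it generates a dense
  subgroup, so the conclusion fails.
\<close>

definition ultrahomogeneous :: "('a, 'f, 'r) fo_struct \<Rightarrow> bool" where
  "ultrahomogeneous A \<longleftrightarrow> (\<forall>f\<in>Ism A. \<exists>g\<in>Aut A. f \<subseteq>\<^sub>m g)"

definition Aut_group :: "('a, 'f, 'r) fo_struct \<Rightarrow> ('a \<rightharpoonup> 'a) monoid" where
  "Aut_group A = \<lparr>carrier = Aut A, mult = (\<circ>\<^sub>m), one = Some |` universe A\<rparr>"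

definition Aut_topology :: "('a, 'f, 'r) fo_struct \<Rightarrow> ('a \<rightharpoonup> 'a) topology" where
  "Aut_topology A = topology_generated_by {{g \<in> Aut A. f \<subseteq>\<^sub>m g} | f. f \<in> Ism A}"

definition dense_in :: "'a topology \<Rightarrow> 'a set \<Rightarrow> bool" where
  "dense_in T S \<longleftrightarrow> S \<subseteq> topspace T \<and> T closure_of S = topspace T"

definition nowhere_dense_in :: "'a topology \<Rightarrow> 'a set \<Rightarrow> bool" where
  "nowhere_dense_in T S \<longleftrightarrow> S \<subseteq> topspace T \<and> T interior_of (T closure_of S) = {}"

end

theory Submission
  imports Defs
begin

text \<open>
  The set \<open>X\<close> of the hypothesis is an obstruction to density that a basic open set of pairs can
  impose. If \<open>f\<close> extends \<open>f1\<close> and \<open>g\<close> extends \<open>g1\<close>, then \<open>f\<close> and \<open>g\<close> map \<open>X\<close> onto itself, and so does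
  every element of \<open>\<langle>f, g\<rangle>\<close>, because the setwise stabiliser of \<open>X\<close> is a subgroup
  (\<open>generate_fixes_set\<close>). By ultrahomogeneity the partial isomorphism \<open>h\<close>, which moves \<open>X\<close> out of
  itself, extends to an automorphism; so the automorphisms extending \<open>h\<close> form a nonempty open set
  that misses \<open>\<langle>f, g\<rangle>\<close>, and \<open>\<langle>f, g\<rangle>\<close> is not dense.

  Thus inside every basic open set of pairs, given by \<open>f0\<close> and \<open>g0\<close>, there is a smaller one,
  given by \<open>f1\<close> and \<open>g1\<close> and nonempty by ultrahomogeneity again, in which no pair generates a dense
  subgroup. Hence the closure of the set of generating pairs has empty interior.

  What the argument needs about the topology is that the sets of automorphisms extending a partial
  isomorphism form a base, and not merely a subbase, of a topology on all of \<open>Aut A\<close>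
  (\<open>openin_Aut_topology_base\<close>). This is where finitely generated substructures have to be finite:
  the restriction of an automorphism to the substructure generated by finitely many points is then
  a partial isomorphism.
\<close>

section \<open>Isomorphisms between substructures\<close>

text \<open>
  The preservation clauses of \<open>substructure_iso\<close>, stated for a total function \<open>\<phi>\<close>. With a
  partial map entering as \<open>the \<circ> f\<close>, restriction, composition and inversion of isomorphisms become
  statements about ordinary functions and bijections.
\<close>

definition preserves_on :: "('a, 'f, 'r) fo_struct \<Rightarrow> 'a set \<Rightarrow> ('a \<Rightarrow> 'a) \<Rightarrow> bool" where
  "preserves_on A B \<phi> \<longleftrightarrow>
     (\<forall>s\<in>funs A. \<forall>xs\<in>lists B. length xs = fun_arity A s \<longrightarrow>
        \<phi> (fun_interp A s xs) = fun_interp A s (map \<phi> xs)) \<and>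
     (\<forall>r\<in>rels A. \<forall>xs\<in>lists B. length xs = rel_arity A r \<longrightarrow>
        rel_interp A r (map \<phi> xs) = rel_interp A r xs)"

lemma substructure_iso_iff:
  "substructure_iso A B C f \<longleftrightarrow>
     substructure A B \<and> substructure A C \<and> dom f = B \<and> bij_betw (the \<circ> f) B C \<and>
     preserves_on A B (the \<circ> f)"
proof (cases "substructure A B \<and> dom f = B")
  case True
  then have dom: "dom f = B" and sub: "closed_under_funs A B"
    by (auto simp: substructure_def)
  have ran: "ran f = (the \<circ> f) ` B"
    using dom by (force simp: ran_def image_iff dom_def)
  have inj: "inj_on f B \<longleftrightarrow> inj_on (the \<circ> f) B"
    using dom by (force simp: inj_on_def dom_def)
  have "f (fun_interp A s xs) = Some y \<longleftrightarrow> (the \<circ> f) (fun_interp A s xs) = y"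
    if "s \<in> funs A" "xs \<in> lists B" "length xs = fun_arity A s" for s xs y
  proof -
    have "fun_interp A s xs \<in> dom f"
      using sub dom that by (auto simp: closed_under_funs_def)
    then show ?thesis by auto
  qed
  then show ?thesis
    unfolding substructure_iso_def preserves_on_def bij_betw_def inj ran by auto
qed (auto simp: substructure_iso_def)

lemma preserves_on_subset:
  "preserves_on A C \<phi> \<Longrightarrow> B \<subseteq> C \<Longrightarrow> preserves_on A B \<phi>"
  unfolding preserves_on_def using lists_mono[of B C] by (meson in_mono)

lemma preserves_on_cong:
  assumes "preserves_on A B \<phi>" "closed_under_funs A B" "\<And>x. x \<in> B \<Longrightarrow> \<phi> x = \<psi> x"
  shows "preserves_on A B \<psi>"
proof -
  have "map \<psi> xs = map \<phi> xs" if "xs \<in> lists B" for xs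
    using that assms(3) by auto
  moreover have "\<psi> (fun_interp A s xs) = \<phi> (fun_interp A s xs)"
    if "s \<in> funs A" "xs \<in> lists B" "length xs = fun_arity A s" for s xs
    using that assms(2,3) by (simp add: closed_under_funs_def)
  ultimately show ?thesis
    using assms(1) unfolding preserves_on_def by metis
qed

lemma preserves_on_comp:
  assumes "preserves_on A B \<phi>" "\<phi> ` B \<subseteq> C" "preserves_on A C \<psi>"
  shows "preserves_on A B (\<psi> \<circ> \<phi>)"
proof -
  have "map \<phi> xs \<in> lists C" if "xs \<in> lists B" for xs
    using that assms(2) by (auto simp: image_subset_iff)
  then show ?thesis
    using assms(1,3) unfolding preserves_on_def by (simp flip: map_map)
qed

lemma preserves_on_inv_into:
  assumes pres: "preserves_on A B \<phi>" and bij: "bij_betw \<phi> B C" and cl: "closed_under_funs A B"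
  shows "preserves_on A C (inv_into B \<phi>)"
proof -
  have inv: "map (inv_into B \<phi>) ys \<in> lists B" "map \<phi> (map (inv_into B \<phi>) ys) = ys"
    if "ys \<in> lists C" for ys
    using that bij by (auto simp: bij_betw_def inv_into_into f_inv_into_f map_idI in_lists_conv_set)
  have "inv_into B \<phi> (fun_interp A s ys) = fun_interp A s (map (inv_into B \<phi>) ys)"
    if "s \<in> funs A" "ys \<in> lists C" "length ys = fun_arity A s" for s ys
  proof -
    let ?xs = "map (inv_into B \<phi>) ys"
    have "\<phi> (fun_interp A s ?xs) = fun_interp A s ys"
      using pres inv[OF that(2)] that unfolding preserves_on_def by (metis length_map)
    moreover have "fun_interp A s ?xs \<in> B"
      using cl inv(1)[OF that(2)] that by (simp add: closed_under_funs_def)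
    ultimately show ?thesis
      using bij by (metis bij_betw_inv_into_left)
  qed
  moreover have "rel_interp A r (map (inv_into B \<phi>) ys) = rel_interp A r ys"
    if "r \<in> rels A" "ys \<in> lists C" "length ys = rel_arity A r" for r ys
    using pres inv[OF that(2)] that unfolding preserves_on_def by (metis length_map)
  ultimately show ?thesis
    unfolding preserves_on_def by blast
qed

lemma closed_under_funs_image:
  assumes "preserves_on A B \<phi>" "closed_under_funs A B"
  shows "closed_under_funs A (\<phi> ` B)"
  unfolding closed_under_funs_def
proof (intro ballI impI)
  fix s ys
  assume s: "s \<in> funs A" and ys: "ys \<in> lists (\<phi> ` B)" "length ys = fun_arity A s"
  then obtain xs where "xs \<in> lists B" "ys = map \<phi> xs"
    by (auto simp: lists_image)
  then show "fun_interp A s ys \<in> \<phi> ` B"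
    using assms s ys unfolding preserves_on_def closed_under_funs_def
    by (metis imageI length_map)
qed

lemma substructure_iso_restrict:
  assumes "substructure_iso A C D f" "substructure A B" "B \<subseteq> C"
  shows "substructure_iso A B ((the \<circ> f) ` B) (f |` B)"
proof -
  have f: "dom f = C" "bij_betw (the \<circ> f) C D" "preserves_on A B (the \<circ> f)" "substructure A D"
    using assms preserves_on_subset by (auto simp: substructure_iso_iff)
  have "substructure A ((the \<circ> f) ` B)"
    using f assms closed_under_funs_image[OF f(3)]
    unfolding substructure_def bij_betw_def by blast
  moreover have "preserves_on A B (the \<circ> (f |` B))"
    using assms(2) by (intro preserves_on_cong[OF f(3)]) (auto simp: substructure_def)
  moreover have "bij_betw (the \<circ> (f |` B)) B ((the \<circ> f) ` B)"
    using f(2) assms(3) inj_on_subset[of "the \<circ> f" C B]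
    by (auto simp: bij_betw_def inj_on_def)
  ultimately show ?thesis
    using assms f(1) by (auto simp: substructure_iso_iff)
qed

lemma substructure_iso_comp:
  assumes g: "substructure_iso A B C g" and f: "substructure_iso A C D f"
  shows "substructure_iso A B D (f \<circ>\<^sub>m g)"
proof -
  have C: "the (g x) \<in> C" if "x \<in> B" for x
    using g that by (auto simp: substructure_iso_iff bij_betw_def)
  have eq: "(the \<circ> (f \<circ>\<^sub>m g)) x = ((the \<circ> f) \<circ> (the \<circ> g)) x" if "x \<in> B" for x
    using g that by (auto simp: substructure_iso_iff map_comp_def split: option.splits)
  have "preserves_on A B ((the \<circ> f) \<circ> (the \<circ> g))"
    using f g by (intro preserves_on_comp[where C = C]) (auto simp: substructure_iso_iff bij_betw_def)
  then have "preserves_on A B (the \<circ> (f \<circ>\<^sub>m g))"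
    by (rule preserves_on_cong)
      (use g eq in \<open>auto simp: substructure_iso_iff substructure_def\<close>)
  moreover have "bij_betw (the \<circ> (f \<circ>\<^sub>m g)) B D"
    using bij_betw_trans[of "the \<circ> g" B C "the \<circ> f" D] f g
      bij_betw_cong[of B "the \<circ> (f \<circ>\<^sub>m g)" "(the \<circ> f) \<circ> (the \<circ> g)" D, OF eq]
    by (simp add: substructure_iso_iff)
  moreover have "dom (f \<circ>\<^sub>m g) = B"
  proof -
    have "x \<in> dom (f \<circ>\<^sub>m g) \<longleftrightarrow> x \<in> B" for x
      using f g C[of x] by (cases "g x") (auto simp: substructure_iso_iff domIff)
    then show ?thesis by blast
  qed
  ultimately show ?thesis
    using f g by (simp add: substructure_iso_iff)
qed

lemma substructure_iso_inverse:
  assumes f: "substructure_iso A B C f"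
  obtains g where "substructure_iso A C B g" "g \<circ>\<^sub>m f = Some |` B"
proof
  let ?i = "inv_into B (the \<circ> f)"
  let ?g = "(Some \<circ> ?i) |` C"
  have bij: "bij_betw (the \<circ> f) B C" and dom: "dom f = B"
    using f by (auto simp: substructure_iso_iff)
  have "preserves_on A C ?i"
    using f by (intro preserves_on_inv_into) (auto simp: substructure_iso_iff substructure_def)
  then have "preserves_on A C (the \<circ> ?g)"
    by (rule preserves_on_cong)
      (use f in \<open>auto simp: substructure_iso_iff substructure_def\<close>)
  moreover have "bij_betw (the \<circ> ?g) C B"
    using bij_betw_inv_into[OF bij] bij_betw_cong[of C ?i "the \<circ> ?g" B] by simp
  ultimately show "substructure_iso A C B ?g"
    using f by (simp add: substructure_iso_iff dom_def restrict_map_def)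
  show "?g \<circ>\<^sub>m f = Some |` B"
  proof
    fix x
    show "(?g \<circ>\<^sub>m f) x = (Some |` B) x"
    proof (cases "x \<in> B")
      case True
      then obtain y where "f x = Some y" using dom by auto
      moreover from this True have "y \<in> C" "?i y = x"
        using bij bij_betw_inv_into_left[OF bij True] by (force simp: bij_betw_def)+
      ultimately show ?thesis using True by simp
    next
      case False
      then have "f x = None" using dom by auto
      then show ?thesis using False by simp
    qed
  qed
qed

lemma substructure_iso_id:
  assumes "substructure A B"
  shows "substructure_iso A B B (Some |` B)"
proof -
  have "preserves_on A B (the \<circ> (Some |` B))"
  proof (rule preserves_on_cong)
    show "preserves_on A B id" by (simp add: preserves_on_def)
  qed (use assms in \<open>auto simp: substructure_def\<close>)
  moreover have "bij_betw (the \<circ> (Some |` B)) B B"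
    by (auto simp: bij_betw_def inj_on_def)
  ultimately show ?thesis
    using assms by (simp add: substructure_iso_iff dom_def restrict_map_def)
qed

section \<open>The automorphism group and setwise stabilisers\<close>

lemma group_Aut_group:
  assumes "fo_structure A"
  shows "group (Aut_group A)"
proof (rule groupI)
  fix f g h :: "'a \<rightharpoonup> 'a"
  assume f: "f \<in> carrier (Aut_group A)" and g: "g \<in> carrier (Aut_group A)"
  show "f \<otimes>\<^bsub>Aut_group A\<^esub> g \<in> carrier (Aut_group A)"
    using f g substructure_iso_comp by (auto simp: Aut_group_def Aut_def)
  show "f \<otimes>\<^bsub>Aut_group A\<^esub> g \<otimes>\<^bsub>Aut_group A\<^esub> h = f \<otimes>\<^bsub>Aut_group A\<^esub> (g \<otimes>\<^bsub>Aut_group A\<^esub> h)"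
    by (auto simp: Aut_group_def map_comp_def fun_eq_iff split: option.splits)
next
  show "\<one>\<^bsub>Aut_group A\<^esub> \<in> carrier (Aut_group A)"
    using assms substructure_iso_id[of A "universe A"]
    by (simp add: Aut_group_def Aut_def fo_structure_def substructure_def)
next
  fix f assume f: "f \<in> carrier (Aut_group A)"
  then have "ran f \<subseteq> universe A"
    by (simp add: Aut_group_def Aut_def substructure_iso_def)
  then have "(Some |` universe A \<circ>\<^sub>m f) x = f x" for x
    by (cases "f x") (auto simp: ran_def restrict_map_def)
  then show "\<one>\<^bsub>Aut_group A\<^esub> \<otimes>\<^bsub>Aut_group A\<^esub> f = f"
    by (auto simp: Aut_group_def)
  from f have "substructure_iso A (universe A) (universe A) f"
    by (simp add: Aut_group_def Aut_def)
  then obtain g where "substructure_iso A (universe A) (universe A) g"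
      "g \<circ>\<^sub>m f = Some |` universe A"
    by (rule substructure_iso_inverse)
  then show "\<exists>g\<in>carrier (Aut_group A). g \<otimes>\<^bsub>Aut_group A\<^esub> f = \<one>\<^bsub>Aut_group A\<^esub>"
    by (auto simp: Aut_group_def Aut_def)
qed

lemma ran_map_comp_restrict: "ran ((f \<circ>\<^sub>m g) |` X) = ran (f |` ran (g |` X))"
  by (auto simp: ran_def restrict_map_def map_comp_def split: option.splits if_splits)

lemma ran_restrict_map_le:
  assumes "f \<subseteq>\<^sub>m g" "X \<subseteq> dom f"
  shows "ran (g |` X) = ran (f |` X)"
proof -
  have "(g |` X) x = (f |` X) x" for x
    using assms by (cases "x \<in> X") (auto simp: map_le_def subset_iff)
  then have "g |` X = f |` X" ..
  then show ?thesis by simp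
qed

text \<open>
  The stabiliser is taken as the automorphisms mapping \<open>X\<close> \<^emph>\<open>onto\<close> itself; with mere inclusion it
  would not be closed under inverses for infinite \<open>X\<close>.
\<close>

lemma generate_fixes_set:
  assumes A: "fo_structure A" and "X \<subseteq> universe A" and "S \<subseteq> Aut A"
    and fix_X: "\<And>f. f \<in> S \<Longrightarrow> ran (f |` X) = X"
    and "k \<in> generate (Aut_group A) S"
  shows "ran (k |` X) = X"
  using assms(5)
proof (induction rule: generate.induct)
  case one
  have "ran ((Some |` universe A) |` X) = X"
    using \<open>X \<subseteq> universe A\<close> by (auto simp: ran_def restrict_map_def)
  then show ?case by (simp add: Aut_group_def)
next
  case (incl f)
  then show ?case by (rule fix_X)
next
  case (inv f)
  interpret group "Aut_group A" by (rule group_Aut_group[OF A])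
  let ?g = "inv\<^bsub>Aut_group A\<^esub> f"
  have "f \<in> carrier (Aut_group A)"
    using inv \<open>S \<subseteq> Aut A\<close> by (auto simp: Aut_group_def)
  from l_inv[OF this] have gf: "?g \<circ>\<^sub>m f = Some |` universe A"
    by (simp add: Aut_group_def)
  have "ran (?g |` X) = ran (?g |` ran (f |` X))"
    using fix_X[OF inv] by simp
  also have "\<dots> = ran ((Some |` universe A) |` X)"
    by (simp only: gf flip: ran_map_comp_restrict)
  also have "\<dots> = X"
    using \<open>X \<subseteq> universe A\<close> by (auto simp: ran_def restrict_map_def)
  finally show ?case .
next
  case (eng f g)
  then show ?case
    by (simp add: Aut_group_def ran_map_comp_restrict)
qed

section \<open>A base of the topology\<close>

abbreviation extensions :: "('a, 'f, 'r) fo_struct \<Rightarrow> ('a \<rightharpoonup> 'a) \<Rightarrow> ('a \<rightharpoonup> 'a) set" where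
  "extensions A f \<equiv> {g \<in> Aut A. f \<subseteq>\<^sub>m g}"

lemma substructure_generated:
  assumes "fo_structure A" "S \<subseteq> universe A"
  shows "substructure A (generated_substructure A S)" "S \<subseteq> generated_substructure A S"
proof -
  have "substructure A (universe A)"
    using assms by (simp add: substructure_def fo_structure_def)
  then have "generated_substructure A S \<subseteq> universe A"
    using assms by (auto simp: generated_substructure_def)
  moreover have "closed_under_funs A (generated_substructure A S)"
    unfolding closed_under_funs_def
  proof (intro ballI impI)
    fix s xs
    assume "s \<in> funs A" "xs \<in> lists (generated_substructure A S)" "length xs = fun_arity A s"
    moreover from this have "xs \<in> lists B" if "substructure A B" "S \<subseteq> B" for B
      using that by (auto simp: generated_substructure_def)
    ultimately show "fun_interp A s xs \<in> generated_substructure A S"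
      by (auto simp: generated_substructure_def substructure_def closed_under_funs_def)
  qed
  ultimately show "substructure A (generated_substructure A S)"
    by (simp add: substructure_def)
  show "S \<subseteq> generated_substructure A S"
    by (auto simp: generated_substructure_def)
qed

lemma Aut_restricts_to_Ism:
  assumes "fo_structure A" "finitely_generated_finite A" "g \<in> Aut A" "finite S" "S \<subseteq> universe A"
  obtains f where "f \<in> Ism A" "f \<subseteq>\<^sub>m g" "S \<subseteq> dom f"
proof
  let ?B = "generated_substructure A S"
  have fin: "finite ?B"
    using assms by (simp add: finitely_generated_finite_def)
  have sub: "substructure A ?B" "S \<subseteq> ?B"
    using substructure_generated[OF assms(1,5)] by auto
  then have "?B \<subseteq> universe A"
    by (simp add: substructure_def)
  then have "substructure_iso A ?B ((the \<circ> g) ` ?B) (g |` ?B)"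
    using assms(3) sub substructure_iso_restrict by (auto simp: Aut_def)
  then show "g |` ?B \<in> Ism A"
    using fin unfolding Ism_def by blast
  show "g |` ?B \<subseteq>\<^sub>m g"
    by (auto simp: map_le_def)
  show "S \<subseteq> dom (g |` ?B)"
    using assms(3) sub \<open>?B \<subseteq> universe A\<close> by (auto simp: Aut_def substructure_iso_def)
qed

lemma openin_extensions: "f \<in> Ism A \<Longrightarrow> openin (Aut_topology A) (extensions A f)"
  unfolding Aut_topology_def by (intro topology_generated_by_Basis) auto

lemma topspace_Aut_topology:
  assumes "fo_structure A" "finitely_generated_finite A"
  shows "topspace (Aut_topology A) = Aut A"
proof
  show "topspace (Aut_topology A) \<subseteq> Aut A"
    by (auto simp: Aut_topology_def)
  show "Aut A \<subseteq> topspace (Aut_topology A)"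
  proof
    fix g assume g: "g \<in> Aut A"
    then obtain f where "f \<in> Ism A" "f \<subseteq>\<^sub>m g"
      using Aut_restricts_to_Ism[OF assms, of g "{}"] by auto
    then show "g \<in> topspace (Aut_topology A)"
      using g by (auto simp: Aut_topology_def)
  qed
qed

text \<open>
  Two partial isomorphisms below the same automorphism \<open>g\<close> have a common extension below \<open>g\<close>, the
  restriction of \<open>g\<close> to the substructure generated by both domains; this gives the case of an
  intersection.
\<close>

lemma openin_Aut_topology_base:
  assumes A: "fo_structure A" "finitely_generated_finite A"
    and "openin (Aut_topology A) U" "g \<in> U"
  obtains f where "f \<in> Ism A" "f \<subseteq>\<^sub>m g" "extensions A f \<subseteq> U"
proof -
  have "generate_topology_on {extensions A f | f. f \<in> Ism A} U"
    using assms(3) by (simp add: Aut_topology_def openin_topology_generated_by)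
  then have "\<exists>f\<in>Ism A. f \<subseteq>\<^sub>m g \<and> extensions A f \<subseteq> U"
    using \<open>g \<in> U\<close>
  proof (induction arbitrary: g rule: generate_topology_on.induct)
    case Empty
    then show ?case by simp
  next
    case (Int U V)
    from Int.IH[of g] Int.prems obtain f f' where
      f: "f \<in> Ism A" "f \<subseteq>\<^sub>m g" "extensions A f \<subseteq> U" and
      f': "f' \<in> Ism A" "f' \<subseteq>\<^sub>m g" "extensions A f' \<subseteq> V"
      by auto
    have "openin (Aut_topology A) U"
      using Int.hyps(1) by (simp add: Aut_topology_def openin_topology_generated_by_iff)
    then have "g \<in> Aut A"
      using Int.prems openin_subset topspace_Aut_topology[OF A] by blast
    moreover have "finite (dom f \<union> dom f')" "dom f \<union> dom f' \<subseteq> universe A"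
      using f(1) f'(1) by (auto simp: Ism_def substructure_iso_def substructure_def)
    ultimately obtain e where e: "e \<in> Ism A" "e \<subseteq>\<^sub>m g" "dom f \<union> dom f' \<subseteq> dom e"
      using Aut_restricts_to_Ism[OF A] by metis
    have "f \<subseteq>\<^sub>m e" "f' \<subseteq>\<^sub>m e"
      using f(2) f'(2) e(2,3) unfolding map_le_def by (metis Un_iff subsetD)+
    then have "extensions A e \<subseteq> U \<inter> V"
      using f(3) f'(3) map_le_trans by blast
    then show ?case
      using e by blast
  next
    case (UN K)
    then obtain U where "U \<in> K" "g \<in> U" by blast
    with UN.IH[of U g] show ?case by blast
  next
    case (Basis U)
    then show ?case by blast
  qed
  then show ?thesis
    using that by blast
qed

section \<open>Pairs generating a dense subgroup\<close>

lemma not_dense_if_fixes_set: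
  assumes A: "fo_structure A" "finitely_generated_finite A" "ultrahomogeneous A"
    and "H \<subseteq> Aut A" and fix_X: "\<And>k. k \<in> H \<Longrightarrow> ran (k |` X) = X"
    and h: "h \<in> Ism A" "X \<subseteq> dom h" "\<not> ran (h |` X) \<subseteq> X"
  shows "\<not> dense_in (Aut_topology A) H"
proof
  assume dense: "dense_in (Aut_topology A) H"
  obtain k where "k \<in> extensions A h"
    using A(3) h(1) by (auto simp: ultrahomogeneous_def)
  moreover from this have "k \<in> Aut_topology A closure_of H"
    using dense topspace_Aut_topology[OF A(1,2)] by (simp add: dense_in_def)
  ultimately have "extensions A h \<inter> H \<noteq> {}"
    using openin_Int_closure_of_eq_empty[OF openin_extensions[OF h(1)], of H] by blast
  then obtain k' where "k' \<in> H" "h \<subseteq>\<^sub>m k'"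
    by blast
  then have "ran (h |` X) = X"
    using ran_restrict_map_le[OF _ h(2)] fix_X by metis
  then show False
    using h(3) by simp
qed

theorem proposition7p1:
  fixes A :: "('a, 'f, 'r) fo_struct"
  assumes "fo_structure A"
    and "countable (universe A)"
    and "finitely_generated_finite A"
    and "ultrahomogeneous A"
    and "\<forall>f0\<in>Ism A. \<forall>g0\<in>Ism A.
           \<exists>X f1 g1 h. finite X \<and> X \<subseteq> universe A \<and> f1 \<in> Ism A \<and> g1 \<in> Ism A \<and> h \<in> Ism A \<and>
             f0 \<subseteq>\<^sub>m f1 \<and> g0 \<subseteq>\<^sub>m g1 \<and>
             X \<subseteq> dom f1 \<inter> dom g1 \<and>
             ran (f1 |` X) = X \<and> ran (g1 |` X) = X \<and>
             X \<subseteq> dom h \<and> \<not> ran (h |` X) \<subseteq> X"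
  shows "nowhere_dense_in (prod_topology (Aut_topology A) (Aut_topology A))
           {(f, g). f \<in> Aut A \<and> g \<in> Aut A \<and>
              dense_in (Aut_topology A) (generate (Aut_group A) {f, g})}"
proof -
  let ?T = "Aut_topology A"
  let ?D = "{(f, g). f \<in> Aut A \<and> g \<in> Aut A \<and> dense_in ?T (generate (Aut_group A) {f, g})}"
  note A = assms(1,3)
  note top = topspace_Aut_topology[OF A]
  have False if "p \<in> prod_topology ?T ?T interior_of (prod_topology ?T ?T closure_of ?D)" for p
  proof -
    from that obtain W where W: "openin (prod_topology ?T ?T) W" "p \<in> W"
      "W \<subseteq> prod_topology ?T ?T closure_of ?D"
      by (auto simp: interior_of_def)
    have "(fst p, snd p) \<in> W"
      using W(2) by simp
    then obtain U V where UV: "openin ?T U" "openin ?T V" "fst p \<in> U" "snd p \<in> V" "U \<times> V \<subseteq> W"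
      using openin_prod_topology_alt[THEN iffD1, rule_format, OF W(1)] by metis
    obtain f0 where f0: "f0 \<in> Ism A" "extensions A f0 \<subseteq> U"
      using openin_Aut_topology_base[OF A UV(1,3)] .
    obtain g0 where g0: "g0 \<in> Ism A" "extensions A g0 \<subseteq> V"
      using openin_Aut_topology_base[OF A UV(2,4)] .
    obtain X f1 g1 h where X: "X \<subseteq> universe A" "X \<subseteq> dom f1 \<inter> dom g1"
        "ran (f1 |` X) = X" "ran (g1 |` X) = X"
      and ext: "f1 \<in> Ism A" "g1 \<in> Ism A" "f0 \<subseteq>\<^sub>m f1" "g0 \<subseteq>\<^sub>m g1"
      and h: "h \<in> Ism A" "X \<subseteq> dom h" "\<not> ran (h |` X) \<subseteq> X"
      using assms(5)[rule_format, OF f0(1) g0(1)] by (elim exE conjE) (rule that)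
    let ?N = "extensions A f1 \<times> extensions A g1"
    have "?N \<subseteq> prod_topology ?T ?T closure_of ?D"
      using f0(2) g0(2) ext(3,4) UV(5) W(3) map_le_trans by blast
    moreover have "?N \<noteq> {}"
      using assms(4) ext(1,2) by (auto simp: ultrahomogeneous_def)
    ultimately have "?N \<inter> (prod_topology ?T ?T closure_of ?D) \<noteq> {}"
      by (simp add: Int_absorb2)
    moreover have "openin (prod_topology ?T ?T) ?N"
      using openin_extensions ext(1,2) by (auto simp: openin_prod_Times_iff)
    ultimately have "?N \<inter> ?D \<noteq> {}"
      by (simp only: openin_Int_closure_of_eq_empty not_False_eq_True)
    then obtain f g where fg: "f \<in> Aut A" "g \<in> Aut A" "f1 \<subseteq>\<^sub>m f" "g1 \<subseteq>\<^sub>m g"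
      and dense: "dense_in ?T (generate (Aut_group A) {f, g})"
      by auto
    have "ran (k |` X) = X" if "k \<in> generate (Aut_group A) {f, g}" for k
    proof (rule generate_fixes_set[OF assms(1) X(1) _ _ that])
      show "{f, g} \<subseteq> Aut A"
        using fg by simp
      show "ran (e |` X) = X" if "e \<in> {f, g}" for e
        using that fg(3,4) X ran_restrict_map_le[of f1 f X] ran_restrict_map_le[of g1 g X] by auto
    qed
    moreover have "generate (Aut_group A) {f, g} \<subseteq> Aut A"
      using dense top by (simp add: dense_in_def)
    ultimately show False
      using not_dense_if_fixes_set[OF A assms(4) _ _ h] dense by blast
  qed
  moreover have "?D \<subseteq> topspace (prod_topology ?T ?T)"
    using top by auto
  ultimately show ?thesis
    unfolding nowhere_dense_in_def by blast
qed

end
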